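(* Let $(\mathcal{R},\partial,\int)$ be an integro-differential ring, let $x_0:=1$ and $x_k:=\int^k1\in\mathcal{R}$ for $k\ge1$, and assume that $\mathrm{E}$ is multiplicative on the integro-differential subring generated by $1$, i.e. $\mathrm{E}(x_mx_n)=0$ for all $m,n\ge1$. Then, for all $n\in\mathbb{N}$, the following identity holds in $\mathcal{R}\langle\partial,\int,\mathrm{E}\rangle$: $$1=\sum_{k=0}^nx_k\cdot\mathrm{E}\cdot\partial^k+\sum_{k=0}^n(-1)^{n-k}x_k\cdot\textstyle\int\cdot x_{n-k}\cdot\partial^{n+1}\displaystyle-\sum_{k=0}^{n-1}\sum_{j=1}^{n-k}(-1)^{n-k-j}x_k\cdot\mathrm{E}\cdot x_j\cdot\textstyle\int\cdot x_{n-k-j}\cdot\partial^{n+1}.$$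
   Context: Rings are unital, nonzero, not necessarily commutative, of arbitrary characteristic; $\mathbb{N}$ contains $0$. A derivation on a ring $\mathcal{R}$ is an additive map $\partial$ with $\partial(fg)=(\partial f)g+f\,\partial g$; $\mathcal{C}=\{f\in\mathcal{R}:\partial f=0\}$ is the ring of constants. "$\mathcal{C}$-linear" means homomorphism of $\mathcal{C}$-bimodules. An integro-differential ring $(\mathcal{R},\partial,\int)$ is a differential ring together with a $\mathcal{C}$-linear map $\int\colon\mathcal{R}\to\mathcal{R}$ satisfying $\partial\int f=f$ for all $f$. Its induced evaluation is $\mathrm{E}f:=f-\int\partial f\in\mathcal{C}$. The ring of integro-differential operators $\mathcal{R}\langle\partial,\int,\mathrm{E}\rangle$ is the (noncommutative unital) ring extension of $\mathcal{R}$ generated by indeterminates $\partial,\int,\mathrm{E}$ that commute with all elements of $\mathcal{C}$, subject to the identities, for all $f\in\mathcal{R}$: $\partial\cdot f=f\cdot\partial+\partial f$, $\ \partial\cdot\int=1$, $\ \int\cdot\partial=1-\mathrm{E}$, $\ \partial\cdot f\cdot\mathrm{E}=\partial f\cdot\mathrm{E}$, $\ \int\cdot f\cdot\mathrm{E}=\int f\cdot\mathrm{E}$, $\ \mathrm{E}\cdot f\cdot\mathrm{E}=\mathrm{E}f\cdot\mathrm{E}$. Here the dot denotes multiplication of operators, whereas $\partial f,\int f,\mathrm{E}f$ without dot denote elements of $\mathcal{R}$. *)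

theory Defs
  imports Main
begin

section \<open>Integro-differential rings\<close>

class differential_ring = ring_1 +
  fixes der :: "'a \<Rightarrow> 'a"
  assumes der_add: "der (f + g) = der f + der g"
    and der_mult: "der (f * g) = der f * g + f * der g"
begin

definition constants :: "'a set"
  where "constants = {f. der f = 0}"

end

text \<open>Multiplication need not be commutative, so linearity over the constants is
  stated on both sides.\<close>

class integro_differential_ring = differential_ring +
  fixes integ :: "'a \<Rightarrow> 'a"
  assumes integ_add: "integ (f + g) = integ f + integ g"
    and integ_const_left: "c \<in> constants \<Longrightarrow> integ (c * f) = c * integ f"
    and integ_const_right: "c \<in> constants \<Longrightarrow> integ (f * c) = integ f * c"
    and der_integ: "der (integ f) = f"
begin

definition evaluation :: "'a \<Rightarrow> 'a"
  where "evaluation f = f - integ (der f)"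

definition xpow :: "nat \<Rightarrow> 'a"
  where "xpow k = (integ ^^ k) 1"

inductive_set subring_one :: "'a set" where
  one: "1 \<in> subring_one"
| add: "f \<in> subring_one \<Longrightarrow> g \<in> subring_one \<Longrightarrow> f + g \<in> subring_one"
| uminus: "f \<in> subring_one \<Longrightarrow> - f \<in> subring_one"
| mult: "f \<in> subring_one \<Longrightarrow> g \<in> subring_one \<Longrightarrow> f * g \<in> subring_one"
| der: "f \<in> subring_one \<Longrightarrow> der f \<in> subring_one"
| integ: "f \<in> subring_one \<Longrightarrow> integ f \<in> subring_one"

inductive_set xspan :: "'a set" where
  xpow: "xpow k \<in> xspan"
| zero: "0 \<in> xspan"
| add: "f \<in> xspan \<Longrightarrow> g \<in> xspan \<Longrightarrow> f + g \<in> xspan"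
| uminus: "f \<in> xspan \<Longrightarrow> - f \<in> xspan"

lemma der_zero [simp]: "der 0 = 0"
  using der_add[of 0 0] by simp

lemma der_one [simp]: "der 1 = 0"
  using der_mult[of 1 1] by simp

lemma der_minus: "der (- f) = - der f"
  using der_add[of f "- f"] by (simp add: eq_neg_iff_add_eq_0 add.commute)

lemma integ_zero [simp]: "integ 0 = 0"
  using integ_add[of 0 0] by simp

lemma integ_minus: "integ (- f) = - integ f"
  using integ_add[of f "- f"] by (simp add: eq_neg_iff_add_eq_0 add.commute)

lemma evaluation_add: "evaluation (f + g) = evaluation f + evaluation g"
  by (simp add: evaluation_def der_add integ_add algebra_simps)

lemma evaluation_zero [simp]: "evaluation 0 = 0"
  by (simp add: evaluation_def)

lemma evaluation_minus: "evaluation (- f) = - evaluation f"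
  by (simp add: evaluation_def der_minus integ_minus)

lemma der_evaluation [simp]: "der (evaluation f) = 0"
proof -
  have "evaluation f + integ (der f) = f"
    by (simp add: evaluation_def)
  then have "der (evaluation f) + der f = der f"
    by (metis der_add der_integ)
  then show ?thesis by simp
qed

lemma evaluation_const: "evaluation f \<in> constants"
  by (simp add: constants_def)

lemma evaluation_const_left: "c \<in> constants \<Longrightarrow> evaluation (c * f) = c * evaluation f"
  by (simp add: evaluation_def der_mult integ_const_left constants_def right_diff_distrib)

lemma evaluation_const_right: "c \<in> constants \<Longrightarrow> evaluation (f * c) = evaluation f * c"
  by (simp add: evaluation_def der_mult integ_const_right constants_def left_diff_distrib)

lemma xpow_0 [simp]: "xpow 0 = 1"
  by (simp add: xpow_def)

lemma xpow_Suc: "xpow (Suc k) = integ (xpow k)"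
  by (simp add: xpow_def)

lemma evaluation_one [simp]: "evaluation 1 = 1"
  by (simp add: evaluation_def)

lemma evaluation_xpow_Suc [simp]: "evaluation (xpow (Suc k)) = 0"
  by (simp add: evaluation_def xpow_Suc der_integ)

lemma xpow_in_subring_one: "xpow k \<in> subring_one"
  by (induction k) (auto simp: xpow_Suc intro: subring_one.intros)

lemma integ_xspan: "f \<in> xspan \<Longrightarrow> integ f \<in> xspan"
  by (induction rule: xspan.induct)
    (auto simp: integ_add integ_minus simp flip: xpow_Suc intro: xspan.intros)

lemma der_xspan: "f \<in> xspan \<Longrightarrow> der f \<in> xspan"
proof (induction rule: xspan.induct)
  case (xpow k)
  then show ?case by (cases k) (auto simp: xpow_Suc der_integ intro: xspan.intros)
qed (auto simp: der_add der_minus intro: xspan.intros)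

lemma mult_xspan:
  assumes E: "\<And>m n. m \<ge> 1 \<Longrightarrow> n \<ge> 1 \<Longrightarrow> evaluation (xpow m * xpow n) = 0"
    and "f \<in> xspan" "g \<in> xspan"
  shows "f * g \<in> xspan"
proof -
  have x: "xpow m * xpow n \<in> xspan" for m n
  proof (induction "m + n" arbitrary: m n rule: less_induct)
    case less
    show ?case
    proof (cases "m = 0 \<or> n = 0")
      case True
      then show ?thesis by (auto intro: xspan.intros)
    next
      case False
      then obtain m' n' where mn: "m = Suc m'" "n = Suc n'"
        by (meson not0_implies_Suc)
      have "xpow m * xpow n = integ (der (xpow m * xpow n))"
        using E[of m n] mn by (simp add: evaluation_def)
      also have "der (xpow m * xpow n) = xpow m' * xpow n + xpow m * xpow n'"
        by (simp add: mn der_mult xpow_Suc der_integ)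
      finally show ?thesis
        using less[of m' n] less[of m n'] mn by (simp add: integ_xspan xspan.add)
    qed
  qed
  have xg: "xpow m * g \<in> xspan" for m
    using \<open>g \<in> xspan\<close>
    by (induction rule: xspan.induct) (auto simp: x distrib_left intro: xspan.intros)
  show ?thesis
    using \<open>f \<in> xspan\<close>
    by (induction rule: xspan.induct) (auto simp: xg distrib_right intro: xspan.intros)
qed

text \<open>Multiplicativity of the evaluation on the integro-differential subring generated
  by 1 is the same as its vanishing on all products of two \<open>xpow\<close>s of positive index.\<close>

lemma evaluation_multiplicative_iff:
  "(\<forall>f\<in>subring_one. \<forall>g\<in>subring_one. evaluation (f * g) = evaluation f * evaluation g) \<longleftrightarrow>
   (\<forall>m\<ge>1. \<forall>n\<ge>1. evaluation (xpow m * xpow n) = 0)"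
  (is "?L \<longleftrightarrow> ?R")
proof
  assume ?L
  show ?R
  proof (intro allI impI)
    fix m n :: nat
    assume "1 \<le> m" "1 \<le> n"
    then obtain m' where "m = Suc m'" by (cases m) auto
    then show "evaluation (xpow m * xpow n) = 0"
      using \<open>?L\<close> by (simp add: xpow_in_subring_one)
  qed
next
  assume R: ?R
  have sub: "f \<in> xspan" if "f \<in> subring_one" for f
    using that
  proof (induction rule: subring_one.induct)
    case one
    then show ?case using xspan.xpow[of 0] by simp
  qed (use R in \<open>auto intro: xspan.intros mult_xspan der_xspan integ_xspan\<close>)
  have x: "evaluation (xpow m * xpow n) = evaluation (xpow m) * evaluation (xpow n)" for m n
    using R by (cases m; cases n) auto
  have xg: "evaluation (xpow m * g) = evaluation (xpow m) * evaluation g" if "g \<in> xspan" for m g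
    using that
    by (induction rule: xspan.induct) (auto simp: x distrib_left evaluation_add evaluation_minus)
  have "evaluation (f * g) = evaluation f * evaluation g" if "f \<in> xspan" "g \<in> xspan" for f g
    using that(1)
    by (induction rule: xspan.induct)
      (auto simp: xg[OF that(2)] distrib_right evaluation_add evaluation_minus)
  then show ?L using sub by blast
qed

end

section \<open>The ring of integro-differential operators\<close>

text \<open>The ring presented by generators and relations: formal ring expressions in the
  elements of \<open>'a\<close> and three indeterminates, modulo the least congruence that contains
  the axioms of unital rings, the ring operations of \<open>'a\<close>, and the defining relations.
  \<open>Coeff 0\<close> and \<open>Coeff 1\<close> serve as zero and one.\<close>

datatype 'a opterm =
  Coeff 'a | Der | Integ | Eval
| Plus "'a opterm" "'a opterm"
| Uminus "'a opterm"
| Times "'a opterm" "'a opterm"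

inductive opcong :: "'a::integro_differential_ring opterm \<Rightarrow> 'a opterm \<Rightarrow> bool" where
  refl: "opcong s s"
| sym: "opcong s t \<Longrightarrow> opcong t s"
| trans: "opcong s t \<Longrightarrow> opcong t u \<Longrightarrow> opcong s u"
| cong_plus: "opcong s s' \<Longrightarrow> opcong t t' \<Longrightarrow> opcong (Plus s t) (Plus s' t')"
| cong_uminus: "opcong s s' \<Longrightarrow> opcong (Uminus s) (Uminus s')"
| cong_times: "opcong s s' \<Longrightarrow> opcong t t' \<Longrightarrow> opcong (Times s t) (Times s' t')"

| plus_assoc: "opcong (Plus (Plus s t) u) (Plus s (Plus t u))"
| plus_commute: "opcong (Plus s t) (Plus t s)"
| plus_zero: "opcong (Plus (Coeff 0) s) s"
| plus_uminus: "opcong (Plus (Uminus s) s) (Coeff 0)"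
| times_assoc: "opcong (Times (Times s t) u) (Times s (Times t u))"
| one_times: "opcong (Times (Coeff 1) s) s"
| times_one: "opcong (Times s (Coeff 1)) s"
| distrib_right: "opcong (Times (Plus s t) u) (Plus (Times s u) (Times t u))"
| distrib_left: "opcong (Times s (Plus t u)) (Plus (Times s t) (Times s u))"

| coeff_plus: "opcong (Coeff (f + g)) (Plus (Coeff f) (Coeff g))"
| coeff_times: "opcong (Coeff (f * g)) (Times (Coeff f) (Coeff g))"

| der_const: "c \<in> constants \<Longrightarrow> opcong (Times Der (Coeff c)) (Times (Coeff c) Der)"
| integ_const: "c \<in> constants \<Longrightarrow> opcong (Times Integ (Coeff c)) (Times (Coeff c) Integ)"
| eval_const: "c \<in> constants \<Longrightarrow> opcong (Times Eval (Coeff c)) (Times (Coeff c) Eval)"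

| der_coeff: "opcong (Times Der (Coeff f)) (Plus (Times (Coeff f) Der) (Coeff (der f)))"
| der_integ: "opcong (Times Der Integ) (Coeff 1)"
| integ_der: "opcong (Times Integ Der) (Plus (Coeff 1) (Uminus Eval))"
| der_eval:
    "opcong (Times Der (Times (Coeff f) Eval)) (Times (Coeff (der f)) Eval)"
| integ_eval:
    "opcong (Times Integ (Times (Coeff f) Eval)) (Times (Coeff (integ f)) Eval)"
| eval_eval:
    "opcong (Times Eval (Times (Coeff f) Eval)) (Times (Coeff (evaluation f)) Eval)"

text \<open>The natural action on \<open>'a\<close>; it shows that distinct coefficients are not identified,
  so that the quotient is indeed a nonzero ring extension of \<open>'a\<close>.\<close>

primrec opact :: "'a::integro_differential_ring opterm \<Rightarrow> 'a \<Rightarrow> 'a" where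
  "opact (Coeff f) h = f * h"
| "opact Der h = der h"
| "opact Integ h = integ h"
| "opact Eval h = evaluation h"
| "opact (Plus s t) h = opact s h + opact t h"
| "opact (Uminus s) h = - opact s h"
| "opact (Times s t) h = opact s (opact t h)"

lemma opact_add: "opact s (g + h) = opact s g + opact s h"
  by (induction s arbitrary: g h)
    (simp_all add: der_add integ_add evaluation_add algebra_simps)

lemma opact_opcong:
  assumes "opcong s t"
  shows "opact s h = opact t h"
  using assms
proof (induction arbitrary: h rule: opcong.induct)
  case (der_eval f)
  then show ?case by (simp add: der_mult)
next
  case (integ_eval f)
  then show ?case by (simp add: integ_const_right[OF evaluation_const])
next
  case (eval_eval f)
  then show ?case by (simp add: evaluation_const_right[OF evaluation_const])
qed (simp_all add: opact_add der_mult integ_const_left evaluation_const_left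
      integro_differential_ring_class.der_integ evaluation_def constants_def algebra_simps)

quotient_type (overloaded) 'a idop =
  "'a::integro_differential_ring opterm" / opcong
  morphisms rep_idop abs_idop
  by (rule equivpI)
    (auto simp: reflp_def symp_def transp_def intro: opcong.refl opcong.sym opcong.trans)

instantiation idop :: (integro_differential_ring) ring_1
begin

lift_definition zero_idop :: "'a idop" is "Coeff 0" .
lift_definition one_idop :: "'a idop" is "Coeff 1" .
lift_definition plus_idop :: "'a idop \<Rightarrow> 'a idop \<Rightarrow> 'a idop" is Plus
  by (rule opcong.cong_plus)
lift_definition uminus_idop :: "'a idop \<Rightarrow> 'a idop" is Uminus
  by (rule opcong.cong_uminus)
lift_definition minus_idop :: "'a idop \<Rightarrow> 'a idop \<Rightarrow> 'a idop" is "\<lambda>s t. Plus s (Uminus t)"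
  by (intro opcong.cong_plus opcong.cong_uminus)
lift_definition times_idop :: "'a idop \<Rightarrow> 'a idop \<Rightarrow> 'a idop" is Times
  by (rule opcong.cong_times)

instance
proof
  fix a b c :: "'a idop"
  show "a + b + c = a + (b + c)" by transfer (rule opcong.plus_assoc)
  show "a + b = b + a" by transfer (rule opcong.plus_commute)
  show "0 + a = a" by transfer (rule opcong.plus_zero)
  show "- a + a = 0" by transfer (rule opcong.plus_uminus)
  show "a - b = a + - b" by transfer (rule opcong.refl)
  show "a * b * c = a * (b * c)" by transfer (rule opcong.times_assoc)
  show "1 * a = a" by transfer (rule opcong.one_times)
  show "a * 1 = a" by transfer (rule opcong.times_one)
  show "(a + b) * c = a * c + b * c" by transfer (rule opcong.distrib_right)
  show "a * (b + c) = a * b + a * c" by transfer (rule opcong.distrib_left)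
  show "(0::'a idop) \<noteq> 1"
  proof (transfer, rule notI)
    assume "opcong (Coeff 0 :: 'a opterm) (Coeff 1)"
    from opact_opcong[OF this, of 1] show False by simp
  qed
qed

end

lift_definition coeff_op :: "'a::integro_differential_ring \<Rightarrow> 'a idop" is Coeff .
lift_definition der_op :: "'a::integro_differential_ring idop" is Der .
lift_definition integ_op :: "'a::integro_differential_ring idop" is Integ .
lift_definition eval_op :: "'a::integro_differential_ring idop" is Eval .

lemma coeff_op_inject: "coeff_op f = coeff_op g \<longleftrightarrow> f = g"
proof (transfer, rule iffI)
  fix f g :: 'a
  assume "opcong (Coeff f) (Coeff g)"
  from opact_opcong[OF this, of 1] show "f = g" by simp
qed (simp add: opcong.refl)

lemma coeff_op_zero [simp]: "coeff_op 0 = 0"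
  by transfer (rule opcong.refl)

lemma coeff_op_one [simp]: "coeff_op 1 = 1"
  by transfer (rule opcong.refl)

lemma coeff_op_add: "coeff_op (f + g) = coeff_op f + coeff_op g"
  by transfer (rule opcong.coeff_plus)

lemma coeff_op_mult: "coeff_op (f * g) = coeff_op f * coeff_op g"
  by transfer (rule opcong.coeff_times)

lemma op_commute_const:
  assumes "c \<in> constants"
  shows "der_op * coeff_op c = coeff_op c * der_op"
    and "integ_op * coeff_op c = coeff_op c * integ_op"
    and "eval_op * coeff_op c = coeff_op c * eval_op"
  using assms
  by (transfer, simp add: opcong.der_const opcong.integ_const opcong.eval_const)+

lemma der_op_coeff: "der_op * coeff_op f = coeff_op f * der_op + coeff_op (der f)"
  by transfer (rule opcong.der_coeff)

lemma der_op_integ_op: "der_op * integ_op = 1"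
  by transfer (rule opcong.der_integ)

lemma integ_op_der_op: "integ_op * der_op = 1 - eval_op"
  by transfer (rule opcong.integ_der)

lemma der_op_coeff_eval: "der_op * coeff_op f * eval_op = coeff_op (der f) * eval_op"
  unfolding mult.assoc by transfer (rule opcong.der_eval)

lemma integ_op_coeff_eval: "integ_op * coeff_op f * eval_op = coeff_op (integ f) * eval_op"
  unfolding mult.assoc by transfer (rule opcong.integ_eval)

lemma eval_op_coeff_eval: "eval_op * coeff_op f * eval_op = coeff_op (evaluation f) * eval_op"
  unfolding mult.assoc by transfer (rule opcong.eval_eval)

end

theory Submission
  imports Defs
begin

text \<open>
  Iterating \<open>1 = E + \<integral>\<cdot>\<partial>\<close> gives Taylor's formula with remainder \<open>\<integral>^(n+1)\<cdot>\<partial>^(n+1)\<close>, so it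
  suffices to show \<open>\<integral>^(n+1) = S n - T n\<close>, where \<open>S n\<close> and \<open>T n\<close> are the last two sums in the claim
  without the factor \<open>\<partial>^(n+1)\<close>. Since the
  alternating convolution of the \<open>x_k\<close> vanishes in positive degree, \<open>\<partial>\<cdot>S (n+1) = S n\<close> and
  \<open>\<partial>\<cdot>T (n+1) = T n\<close>. Since \<open>E\<cdot>\<integral> = 0\<close> and \<open>E\<cdot>x_k\<cdot>E = 0\<close> for positive \<open>k\<close>, also
  \<open>E\<cdot>S n = E\<cdot>T n\<close>. Applying \<open>1 = E + \<integral>\<cdot>\<partial>\<close> to \<open>S (n+1) - T (n+1)\<close> completes an induction on \<open>n\<close>.
\<close>

text \<open>Signs are central even though multiplication need not commute, so they can be moved to
  the front of every product.\<close>

lemma mult_minus_one_power_left_commute: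
  fixes a b :: "'a::ring_1"
  shows "a * ((- 1) ^ m * b) = (- 1) ^ m * (a * b)"
  by (cases "even m") simp_all

lemma der_sum: "der (sum f A) = (\<Sum>i\<in>A. der (f i :: 'a::integro_differential_ring))"
  by (induction A rule: infinite_finite_induct) (simp_all add: der_add)

lemma der_minus_one_power_mult:
  fixes f :: "'a::integro_differential_ring"
  shows "der ((- 1) ^ m * f) = (- 1) ^ m * der f"
  by (cases "even m") (simp_all add: der_minus)

lemma evaluation_sum: "evaluation (sum f A) = (\<Sum>i\<in>A. evaluation (f i))"
  by (induction A rule: infinite_finite_induct) (simp_all add: evaluation_add)

lemma evaluation_minus_one_power_mult:
  "evaluation ((- 1) ^ m * f) = (- 1) ^ m * evaluation f"
  by (cases "even m") (simp_all add: evaluation_minus)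

lemma der_xpow_Suc: "der (xpow (Suc k)) = xpow k"
  by (simp add: xpow_Suc integro_differential_ring_class.der_integ)

text \<open>An element whose derivative and evaluation both vanish is zero, because
  \<open>f = evaluation f + integ (der f)\<close>. The Leibniz rule splits the derivative of this
  sum into two sums that cancel.\<close>

lemma alternating_xpow_convolution:
  assumes E: "\<And>k m :: nat. k \<ge> 1 \<Longrightarrow> m \<ge> 1 \<Longrightarrow>
    evaluation (xpow k * xpow m :: 'a::integro_differential_ring) = 0"
  shows "(\<Sum>k\<le>Suc n. (- 1) ^ (Suc n - k) * (xpow k * xpow (Suc n - k))) = (0::'a)"
    (is "?A = 0")
proof -
  let ?B = "\<Sum>k\<le>n. (- 1) ^ (n - k) * (xpow k * xpow (n - k))"
  have "der ?A = (\<Sum>k\<le>Suc n. (- 1) ^ (Suc n - k) * (der (xpow k) * xpow (Suc n - k)))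
      + (\<Sum>k\<le>Suc n. (- 1) ^ (Suc n - k) * (xpow k * der (xpow (Suc n - k))))"
    by (simp only: der_sum der_minus_one_power_mult der_mult[of "xpow _"]
        semiring_class.distrib_left sum.distrib)
  also have "(\<Sum>k\<le>Suc n. (- 1) ^ (Suc n - k) * (der (xpow k) * xpow (Suc n - k))) = ?B"
    by (simp add: sum.atMost_Suc_shift der_xpow_Suc del: sum.atMost_Suc)
  \<comment> \<open>The summand at \<open>k = Suc n\<close> contains \<open>der 1 = 0\<close>; in
    the others the index of the right factor drops by one while the sign exponent does not, hence
    the minus.\<close>
  also have "(\<Sum>k\<le>Suc n. (- 1) ^ (Suc n - k) * (xpow k * der (xpow (Suc n - k)))) = - ?B"
    by (simp add: Suc_diff_le der_xpow_Suc sum_negf)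
  finally have "der ?A = 0" by simp
  moreover have "evaluation (xpow k * xpow (Suc n - k) :: 'a) = 0" if "k \<le> Suc n" for k
  \<comment> \<open>At both ends one factor is 1 and the other is \<open>xpow (Suc n)\<close>, whose
    evaluation is zero.\<close>
  proof (cases "k = 0 \<or> k = Suc n")
    case False
    then show ?thesis using that by (intro E) auto
  qed auto
  then have "evaluation ?A = 0"
    unfolding evaluation_sum evaluation_minus_one_power_mult
    by (intro sum.neutral) auto
  ultimately show ?thesis
    by (simp only: evaluation_def integ_zero diff_zero)
qed

lemma coeff_op_uminus: "coeff_op (- f) = - coeff_op f"
  using coeff_op_add[of f "- f"] by (simp add: eq_neg_iff_add_eq_0 add.commute)

lemma coeff_op_sum: "coeff_op (sum f A) = (\<Sum>i\<in>A. coeff_op (f i))"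
  by (induction A rule: infinite_finite_induct) (simp_all add: coeff_op_add)

lemma coeff_op_minus_one_power_mult:
  "coeff_op ((- 1) ^ m * f) = (- 1) ^ m * coeff_op f"
  by (cases "even m") (simp_all add: coeff_op_uminus)

lemma eval_op_integ_op: "eval_op * integ_op = 0"
proof -
  have "eval_op * integ_op = (1 - integ_op * der_op) * integ_op"
    by (simp add: integ_op_der_op)
  also have "\<dots> = 0"
    by (simp add: left_diff_distrib mult.assoc der_op_integ_op)
  finally show ?thesis .
qed

lemma integ_op_power_eval_op: "integ_op ^ k * eval_op = coeff_op (xpow k) * eval_op"
proof (induction k)
  case (Suc k)
  then show ?case
    by (simp add: mult.assoc xpow_Suc flip: integ_op_coeff_eval)
qed simp

lemma taylor_integ_power:
  "(\<Sum>k\<le>n. coeff_op (xpow k) * eval_op * der_op ^ k) + integ_op ^ Suc n * der_op ^ Suc n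
    = (1 :: 'a::integro_differential_ring idop)"
proof (induction n)
  case 0
  show ?case by (simp add: integ_op_der_op)
next
  case (Suc n)
  \<comment> \<open>The extra factors are split off at the inner ends, so that
    \<open>integ_op * der_op = 1 - eval_op\<close> appears in the middle.\<close>
  have "integ_op ^ Suc (Suc n) * (der_op ^ Suc (Suc n) :: 'a idop)
      = integ_op ^ Suc n * (integ_op * der_op) * der_op ^ Suc n"
    unfolding power_Suc2[of integ_op "Suc n"] power_Suc[of der_op "Suc n"]
    by (simp only: mult.assoc)
  also have "\<dots> = integ_op ^ Suc n * der_op ^ Suc n
      - integ_op ^ Suc n * eval_op * der_op ^ Suc n"
    by (simp only: integ_op_der_op algebra_simps mult_1_left mult_1_right)
  finally have "integ_op ^ Suc n * (der_op ^ Suc n :: 'a idop) =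
      coeff_op (xpow (Suc n)) * eval_op * der_op ^ Suc n
      + integ_op ^ Suc (Suc n) * der_op ^ Suc (Suc n)"
    by (simp add: integ_op_power_eval_op del: power_Suc)
  then show ?case
    using Suc.IH by (simp add: add.assoc del: power_Suc)
qed

definition convolution_part :: "nat \<Rightarrow> 'a::integro_differential_ring idop" where
  "convolution_part n =
    (\<Sum>k\<le>n. (- 1) ^ (n - k) * (coeff_op (xpow k) * (integ_op * coeff_op (xpow (n - k)))))"

text \<open>The summand at \<open>k = n\<close> is an empty inner sum; keeping it gives the same
  index range as in \<open>convolution_part\<close>. The inner sum is
  \<open>convolution_part (n - k)\<close> without its term of index 0.\<close>

definition evaluation_part :: "nat \<Rightarrow> 'a::integro_differential_ring idop" where
  "evaluation_part n = (\<Sum>k\<le>n. coeff_op (xpow k) * (eval_op *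
    (\<Sum>j=1..n - k. (- 1) ^ (n - k - j) *
      (coeff_op (xpow j) * (integ_op * coeff_op (xpow (n - k - j)))))))"

text \<open>Moving \<open>der_op\<close> past a coefficient and cancelling it against
  \<open>integ_op\<close> leaves the vanishing alternating convolution; the terms with a
  differentiated coefficient give the sum for \<open>n\<close> after an index shift.\<close>

lemma der_op_convolution_part:
  assumes "\<And>k m :: nat. k \<ge> 1 \<Longrightarrow> m \<ge> 1 \<Longrightarrow>
    evaluation (xpow k * xpow m :: 'a::integro_differential_ring) = 0"
  shows "der_op * convolution_part (Suc n) = (convolution_part n :: 'a idop)"
proof -
  have D: "der_op * (coeff_op f * (integ_op * y))
      = coeff_op f * y + coeff_op (der f) * (integ_op * y)" for f :: 'a and y
  proof -
    have "der_op * (coeff_op f * (integ_op * y))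
        = coeff_op f * (der_op * integ_op) * y + coeff_op (der f) * (integ_op * y)"
      by (simp only: mult.assoc[symmetric] der_op_coeff semiring_class.distrib_right)
    then show ?thesis by (simp add: der_op_integ_op)
  qed
  have "der_op * convolution_part (Suc n) =
      (\<Sum>k\<le>Suc n. (- 1) ^ (Suc n - k) * (coeff_op (xpow k) * coeff_op (xpow (Suc n - k))))
    + (\<Sum>k\<le>Suc n. (- 1) ^ (Suc n - k) *
        (coeff_op (der (xpow k)) * (integ_op * coeff_op (xpow (Suc n - k) :: 'a))))"
    by (simp only: convolution_part_def sum_distrib_left mult_minus_one_power_left_commute D
        semiring_class.distrib_left sum.distrib)
  also have "(\<Sum>k\<le>Suc n. (- 1) ^ (Suc n - k) *
        (coeff_op (xpow k) * coeff_op (xpow (Suc n - k) :: 'a))) =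
      coeff_op (\<Sum>k\<le>Suc n. (- 1) ^ (Suc n - k) * (xpow k * xpow (Suc n - k)))"
    by (simp only: coeff_op_sum coeff_op_minus_one_power_mult coeff_op_mult[of "xpow _"])
  also have "\<dots> = 0"
    by (simp only: alternating_xpow_convolution[OF assms] coeff_op_zero)
  also have "(\<Sum>k\<le>Suc n. (- 1) ^ (Suc n - k) *
        (coeff_op (der (xpow k)) * (integ_op * coeff_op (xpow (Suc n - k) :: 'a)))) =
      convolution_part n"
    by (simp add: sum.atMost_Suc_shift der_xpow_Suc convolution_part_def del: sum.atMost_Suc)
  finally show ?thesis by simp
qed

lemma der_op_evaluation_part:
  "der_op * evaluation_part (Suc n) = (evaluation_part n :: 'a::integro_differential_ring idop)"
proof -
  have D: "der_op * (coeff_op f * (eval_op * y)) = coeff_op (der f) * (eval_op * y)"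
    for f :: 'a and y
    by (simp add: der_op_coeff_eval flip: mult.assoc)
  define U :: "nat \<Rightarrow> 'a idop" where "U n = (\<Sum>j=1..n. (- 1) ^ (n - j) *
    (coeff_op (xpow j) * (integ_op * coeff_op (xpow (n - j)))))" for n
  have "der_op * evaluation_part (Suc n) =
      (\<Sum>k\<le>Suc n. coeff_op (der (xpow k)) * (eval_op * U (Suc n - k)))"
    by (simp only: evaluation_part_def sum_distrib_left[of der_op] D flip: U_def)
  also have "\<dots> = (\<Sum>k\<le>n. coeff_op (xpow k) * (eval_op * U (n - k)))"
    by (simp add: sum.atMost_Suc_shift der_xpow_Suc del: sum.atMost_Suc)
  finally show ?thesis
    by (simp only: evaluation_part_def flip: U_def)
qed

text \<open>Both sides equal \<open>eval_op * U n\<close>. On the left the term \<open>k = 0\<close>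
  starts with \<open>integ_op\<close>, which \<open>eval_op\<close> annihilates; on the right only
  \<open>k = 0\<close> survives, since \<open>xpow k\<close> evaluates to zero for positive
  \<open>k\<close>.\<close>

lemma eval_op_convolution_part:
  "eval_op * convolution_part n =
    (eval_op * evaluation_part n :: 'a::integro_differential_ring idop)"
proof -
  have *: "eval_op * (coeff_op f * (eval_op * y)) = coeff_op (evaluation f) * (eval_op * y)"
    for f :: 'a and y
    by (simp add: eval_op_coeff_eval flip: mult.assoc)
  define U :: "nat \<Rightarrow> 'a idop" where "U n = (\<Sum>j=1..n. (- 1) ^ (n - j) *
    (coeff_op (xpow j) * (integ_op * coeff_op (xpow (n - j)))))" for n
  have "convolution_part n = (- 1) ^ n * (integ_op * coeff_op (xpow n)) + U n"
    unfolding convolution_part_def U_def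
    by (simp add: atMost_atLeast0 sum.atLeast_Suc_atMost)
  then have "eval_op * convolution_part n = eval_op * U n"
    by (simp add: semiring_class.distrib_left mult_minus_one_power_left_commute eval_op_integ_op
        flip: mult.assoc[of eval_op integ_op])
  also have "eval_op * U n =
      (\<Sum>k\<le>n. coeff_op (evaluation (xpow k)) * (eval_op * U (n - k)))"
    by (cases n) (simp_all add: sum.atMost_Suc_shift del: sum.atMost_Suc)
  also have "\<dots> = eval_op * evaluation_part n"
    by (simp only: evaluation_part_def sum_distrib_left[of eval_op] * flip: U_def)
  finally show ?thesis .
qed

lemma integ_op_power_Suc:
  assumes "\<And>k m :: nat. k \<ge> 1 \<Longrightarrow> m \<ge> 1 \<Longrightarrow>
    evaluation (xpow k * xpow m :: 'a::integro_differential_ring) = 0"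
  shows "integ_op ^ Suc n = (convolution_part n - evaluation_part n :: 'a idop)"
proof (induction n)
  case 0
  show ?case by (simp add: convolution_part_def evaluation_part_def)
next
  case (Suc n)
  let ?W = "convolution_part (Suc n) - evaluation_part (Suc n) :: 'a idop"
  \<comment> \<open>An operator is recovered from its products with \<open>eval_op\<close> and
    \<open>der_op\<close> on the left.\<close>
  have "?W = (eval_op + integ_op * der_op) * ?W"
    by (simp add: integ_op_der_op)
  also have "\<dots> = eval_op * ?W + integ_op * (der_op * ?W)"
    by (simp only: semiring_class.distrib_right mult.assoc)
  also have "eval_op * ?W = 0"
    by (simp add: right_diff_distrib eval_op_convolution_part)
  also have "der_op * ?W = integ_op ^ Suc n"
    by (simp only: Suc.IH right_diff_distrib der_op_convolution_part[OF assms]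
        der_op_evaluation_part)
  finally show ?case by simp
qed

theorem theorem6p6:
  fixes n :: nat
  assumes "\<And>k m :: nat. k \<ge> 1 \<Longrightarrow> m \<ge> 1 \<Longrightarrow>
    evaluation (xpow k * xpow m :: 'a::integro_differential_ring) = 0"
  shows "(1 :: 'a idop) =
    (\<Sum>k=0..n. coeff_op (xpow k) * eval_op * der_op ^ k)
    + (\<Sum>k=0..n. (- 1) ^ (n - k) * coeff_op (xpow k) * integ_op
        * coeff_op (xpow (n - k)) * der_op ^ (n + 1))
    - (\<Sum>k<n. \<Sum>j=1..n - k. (- 1) ^ (n - k - j) * coeff_op (xpow k) * eval_op
        * coeff_op (xpow j) * integ_op * coeff_op (xpow (n - k - j)) * der_op ^ (n + 1))"
proof -
  have S: "(\<Sum>k=0..n. (- 1) ^ (n - k) * coeff_op (xpow k) * integ_op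
        * coeff_op (xpow (n - k)) * der_op ^ (n + 1)) =
      convolution_part n * (der_op ^ (n + 1) :: 'a idop)"
    by (simp only: convolution_part_def sum_distrib_right mult.assoc atMost_atLeast0)
  have T: "(\<Sum>k<n. \<Sum>j=1..n - k. (- 1) ^ (n - k - j) * coeff_op (xpow k) * eval_op
        * coeff_op (xpow j) * integ_op * coeff_op (xpow (n - k - j)) * der_op ^ (n + 1)) =
      evaluation_part n * (der_op ^ (n + 1) :: 'a idop)"
  proof -
    \<comment> \<open>The empty inner sum at \<open>k = n\<close> is dropped to match the range in
      the claim.\<close>
    have "evaluation_part n = (\<Sum>k<n. coeff_op (xpow k) * (eval_op *
        (\<Sum>j=1..n - k. (- 1) ^ (n - k - j) *
          (coeff_op (xpow j) * (integ_op * coeff_op (xpow (n - k - j) :: 'a))))))"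
      by (simp add: evaluation_part_def flip: lessThan_Suc_atMost)
    then show ?thesis
      by (simp only: sum_distrib_right sum_distrib_left mult.assoc
          mult_minus_one_power_left_commute)
  qed
  show ?thesis
    unfolding S T
    using taylor_integ_power[of n, where 'a = 'a] integ_op_power_Suc[OF assms, of n]
    by (simp add: atMost_atLeast0 left_diff_distrib add_diff_eq del: power_Suc)
qed

end
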